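(* Let $\mathcal{P}$ be a class of distributions and suppose there is $P_0\in\mathcal{P}$ such that: (1) (Contiguity) The set $\mathcal{G}_0=\{g\in\mathcal{G}: B(g;P_0)=k\}$ is non-empty, and $\mathcal{P}$ includes a sequence of distributions $\{P_{h_n}\}_{n\ge 1}$ contiguous to $P_0$ (i.e. the sequence of sampling distributions $P_{h_n}^n$ is contiguous with respect to $P_0^n$) such that for all $g\in\mathcal{G}_0$ there exists some $c>0$ with $\sqrt{n}\,\bigl(B(g;P_{h_n})-k\bigr)>c$ for every $n$. (2) (Binding constraint) $B(g_{P_0}^{\ast};P_0)=k$. (3) (Separation) There exists $\epsilon>0$ such that for every $g\in\mathcal{G}$ with $B(g;P_0)\le k$, whenever $|B(g;P_0)-B(g_{P_0}^{\ast};P_0)|>0$ we have $W(g_{P_0}^{\ast};P_0)-W(g;P_0)>\epsilon$. Then no statistical rule is both uniformly asymptotically welfare-efficient and uniformly asymptotically feasible over $\mathcal{P}$. In particular, if a statistical rule $\widehat{g}$ is pointwise asymptotically welfare-efficient and pointwise asymptotically feasible under $P_0$, then it is not uniformly asymptotically feasible over $\mathcal{P}$.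
   Context: An individual has attributes $A=(\tau,C,X)\in\mathbb{R}^{2+p}$ with joint distribution $P$ (benefit $\tau$, cost $C$, characteristics $X\in\mathcal{X}\subset\mathbb{R}^p$). $\mathcal{G}$ is a given class of policies $g:\mathcal{X}\to\{0,1\}$, and $k\in\mathbb{R}$ is a known budget threshold. Define $W(g;P)=\mathbb{E}_P[\tau\cdot g(X)]$ and $B(g;P)=\mathbb{E}_P[C\cdot g(X)]$. For each $P\in\mathcal{P}$, $g_P^{\ast}$ denotes a solution (assumed to exist) of $\max_{g\in\mathcal{G}}W(g;P)$ subject to $B(g;P)\le k$. For each $n$ one observes a sample of size $n$ whose distribution, induced by $P$, is denoted $P^n$. A statistical rule $\widehat{g}$ is, for each $n$, a (measurable) map from samples of size $n$ to $\mathcal{G}$. $\widehat g$ is pointwise asymptotically welfare-efficient under $P$ if for every $\epsilon>0$, $\lim_{n\to\infty}\Pr_{P^n}\{W(\widehat{g};P)-W(g_P^{\ast};P)<-\epsilon\}=0$; uniformly asymptotically welfare-efficient over $\mathcal{P}$ if for every $\epsilon>0$, $\lim_{n\to\infty}\sup_{P\in\mathcal{P}}\Pr_{P^n}\{W(\widehat{g};P)-W(g_P^{\ast};P)<-\epsilon\}=0$. It is pointwise asymptotically feasible under $P$ if $\lim_{n\to\infty}\Pr_{P^n}\{B(\widehat{g};P)>k\}=0$; uniformly asymptotically feasible over $\mathcal{P}$ if $\lim_{n\to\infty}\sup_{P\in\mathcal{P}}\Pr_{P^n}\{B(\widehat{g};P)>k\}=0$. Contiguity of $Q_n$ with respect to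 $P_n$: $P_n(A_n)\to0$ implies $Q_n(A_n)\to0$ for every sequence of measurable sets $A_n$. *)

theory Defs
  imports "HOL-Probability.Probability"
begin

text \<open>
  An individual's attributes are \<open>(\<tau>, C, X)\<close> with \<open>X\<close> in a set \<open>\<X>\<close> of characteristics.
  Equipping \<open>\<X>\<close> with the trace of the Borel sets puts the restriction \<open>X \<in> \<X>\<close> into the
  attribute space itself, and \<open>\<X>\<close> need not be a Borel set.
\<close>

type_synonym 'p attributes = "real \<times> real \<times> (real ^ 'p)"
type_synonym 'p policy = "real ^ 'p \<Rightarrow> real"

definition attribute_space :: "(real ^ 'p::finite) set \<Rightarrow> 'p attributes measure" where
  "attribute_space \<X> = borel \<Otimes>\<^sub>M (borel \<Otimes>\<^sub>M restrict_space borel \<X>)"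

definition policies :: "(real ^ 'p::finite) set \<Rightarrow> 'p policy set" where
  "policies \<X> = {g \<in> \<X> \<rightarrow>\<^sub>E {0, 1}. g \<in> borel_measurable (restrict_space borel \<X>)}"

definition welfare :: "('p::finite) policy \<Rightarrow> 'p attributes measure \<Rightarrow> real" where
  "welfare g P = (\<integral>(t, c, x). t * g x \<partial>P)"

definition cost :: "('p::finite) policy \<Rightarrow> 'p attributes measure \<Rightarrow> real" where
  "cost g P = (\<integral>(t, c, x). c * g x \<partial>P)"

text \<open>
  Finiteness of the expectations above, needed because the Bochner integral of a
  non-integrable function is \<open>0\<close> by convention.
\<close>

definition finite_welfare_cost :: "('p::finite) policy \<Rightarrow> 'p attributes measure \<Rightarrow> bool" where
  "finite_welfare_cost g P \<longleftrightarrow>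
     integrable P (\<lambda>(t, c, x). t * g x) \<and> integrable P (\<lambda>(t, c, x). c * g x)"

definition constrained_optimum ::
    "('p::finite) policy set \<Rightarrow> real \<Rightarrow> 'p attributes measure \<Rightarrow> 'p policy \<Rightarrow> bool" where
  "constrained_optimum \<G> k P g \<longleftrightarrow>
     is_arg_max (\<lambda>g. welfare g P) (\<lambda>g. g \<in> \<G> \<and> cost g P \<le> k) g"

text \<open>
  A sample of size \<open>n\<close> consists of \<open>n\<close> observations in a measurable space \<open>Z\<close>, which need
  not be the attribute space (\<open>\<tau>\<close> is typically not observed). The distribution \<open>P\<^sup>n\<close> of the
  sample is given below by \<open>D P n\<close>, an arbitrary probability measure on the sample space:
  the observations are not assumed independent or identically distributed.
\<close>

definition sample_space :: "'z measure \<Rightarrow> nat \<Rightarrow> (nat \<Rightarrow> 'z) measure" where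
  "sample_space Z n = (\<Pi>\<^sub>M i\<in>{1..n}. Z)"

text \<open>
  Measurability of a rule is with respect to the coarsest \<open>\<sigma>\<close>-algebra on \<open>\<G>\<close> that makes
  \<open>g \<mapsto> welfare g P\<close> and \<open>g \<mapsto> cost g P\<close> measurable for every \<open>P \<in> \<P>\<close>.
\<close>

definition statistical_rule ::
    "('p::finite) policy set \<Rightarrow> 'p attributes measure set \<Rightarrow> 'z measure
      \<Rightarrow> (nat \<Rightarrow> (nat \<Rightarrow> 'z) \<Rightarrow> 'p policy) \<Rightarrow> bool" where
  "statistical_rule \<G> \<P> Z r \<longleftrightarrow>
     (\<forall>n\<ge>1. r n \<in> space (sample_space Z n) \<rightarrow> \<G> \<and>
       (\<forall>P\<in>\<P>. (\<lambda>s. welfare (r n s) P) \<in> borel_measurable (sample_space Z n) \<and>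
               (\<lambda>s. cost (r n s) P) \<in> borel_measurable (sample_space Z n)))"

definition pointwise_efficient ::
    "('p attributes measure \<Rightarrow> nat \<Rightarrow> (nat \<Rightarrow> 'z) measure) \<Rightarrow> ('p attributes measure \<Rightarrow> 'p policy)
      \<Rightarrow> ('p::finite) attributes measure \<Rightarrow> (nat \<Rightarrow> (nat \<Rightarrow> 'z) \<Rightarrow> 'p policy) \<Rightarrow> bool" where
  "pointwise_efficient D gs P r \<longleftrightarrow>
     (\<forall>\<epsilon>>0. (\<lambda>n. \<P>(s in D P n. welfare (r n s) P - welfare (gs P) P < - \<epsilon>)) \<longlonglongrightarrow> 0)"

definition uniformly_efficient ::
    "('p attributes measure \<Rightarrow> nat \<Rightarrow> (nat \<Rightarrow> 'z) measure) \<Rightarrow> ('p attributes measure \<Rightarrow> 'p policy)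
      \<Rightarrow> ('p::finite) attributes measure set \<Rightarrow> (nat \<Rightarrow> (nat \<Rightarrow> 'z) \<Rightarrow> 'p policy) \<Rightarrow> bool" where
  "uniformly_efficient D gs \<P> r \<longleftrightarrow>
     (\<forall>\<epsilon>>0. (\<lambda>n. SUP P\<in>\<P>. \<P>(s in D P n. welfare (r n s) P - welfare (gs P) P < - \<epsilon>)) \<longlonglongrightarrow> 0)"

definition pointwise_feasible ::
    "('p attributes measure \<Rightarrow> nat \<Rightarrow> (nat \<Rightarrow> 'z) measure) \<Rightarrow> real
      \<Rightarrow> ('p::finite) attributes measure \<Rightarrow> (nat \<Rightarrow> (nat \<Rightarrow> 'z) \<Rightarrow> 'p policy) \<Rightarrow> bool" where
  "pointwise_feasible D k P r \<longleftrightarrow>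
     (\<lambda>n. \<P>(s in D P n. cost (r n s) P > k)) \<longlonglongrightarrow> 0"

definition uniformly_feasible ::
    "('p attributes measure \<Rightarrow> nat \<Rightarrow> (nat \<Rightarrow> 'z) measure) \<Rightarrow> real
      \<Rightarrow> ('p::finite) attributes measure set \<Rightarrow> (nat \<Rightarrow> (nat \<Rightarrow> 'z) \<Rightarrow> 'p policy) \<Rightarrow> bool" where
  "uniformly_feasible D k \<P> r \<longleftrightarrow>
     (\<lambda>n. SUP P\<in>\<P>. \<P>(s in D P n. cost (r n s) P > k)) \<longlonglongrightarrow> 0"

text \<open>\<open>contiguous Q P\<close>: the sequence \<open>Q\<close> is contiguous with respect to the sequence \<open>P\<close>.\<close>

definition contiguous :: "(nat \<Rightarrow> 'a measure) \<Rightarrow> (nat \<Rightarrow> 'a measure) \<Rightarrow> bool" where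
  "contiguous Q P \<longleftrightarrow>
     (\<forall>A. (\<forall>n. A n \<in> sets (P n)) \<longrightarrow> (\<lambda>n. measure (P n) (A n)) \<longlonglongrightarrow> 0
            \<longrightarrow> (\<lambda>n. measure (Q n) (A n)) \<longlonglongrightarrow> 0)"

end

theory Submission
  imports Defs
begin

text \<open>
  Under \<open>P\<^sub>0\<close> an efficient and feasible rule must select, with probability tending to one, a
  policy on the boundary \<open>cost g P\<^sub>0 = k\<close>: policies above it are excluded by feasibility, and
  those below it lose at least \<open>\<epsilon>\<close> of welfare by separation. By contiguity the same holds
  under the local alternatives, where every boundary policy violates the constraint. So the
  probability of violation tends to one along them.
\<close>

text \<open>Contiguity quantifies over sets that are measurable at every index, but nothing is
  assumed about \<open>D P 0\<close>. Putting the empty set at the finitely many bad indices changes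
  no limit.\<close>

lemma contiguousD:
  assumes "contiguous Q P"
    and "\<forall>\<^sub>F n in sequentially. A n \<in> sets (P n)"
    and "(\<lambda>n. measure (P n) (A n)) \<longlonglongrightarrow> 0"
  shows "(\<lambda>n. measure (Q n) (A n)) \<longlonglongrightarrow> 0"
proof -
  define A' where "A' n = (if A n \<in> sets (P n) then A n else {})" for n
  have eq: "\<forall>\<^sub>F n in sequentially. A' n = A n"
    using assms(2) by eventually_elim (simp add: A'_def)
  have "(\<lambda>n. measure (P n) (A' n)) \<longlonglongrightarrow> 0"
    by (rule Lim_transform_eventually[OF assms(3)]) (use eq in eventually_elim, simp)
  moreover have "A' n \<in> sets (P n)" for n
    by (simp add: A'_def)
  ultimately have "(\<lambda>n. measure (Q n) (A' n)) \<longlonglongrightarrow> 0"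
    using assms(1) unfolding contiguous_def by blast
  then show ?thesis
    by (rule Lim_transform_eventually) (use eq in eventually_elim, simp)
qed

text \<open>A real supremum bounds its family only if the family is bounded above; here the bound 1
  on probabilities ensures this.\<close>

lemma prob_le_SUP:
  assumes "\<And>P. P \<in> \<P> \<Longrightarrow> prob_space (M P)" and "P \<in> \<P>"
  shows "measure (M P) (A P) \<le> (SUP P\<in>\<P>. measure (M P) (A P))"
  using assms by (intro cSUP_upper bdd_aboveI2[where M = 1] prob_space.prob_le_1)

text \<open>\<open>Q\<close> may move with \<open>n\<close>: uniform control is used both along the
  drifting alternatives \<open>Ph\<close> and, with \<open>Q\<close> constant, at
  \<open>P0\<close>.\<close>

lemma tendsto_zero_of_SUP:
  fixes M :: "'a \<Rightarrow> nat \<Rightarrow> 'b measure"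
  assumes lim: "(\<lambda>n. SUP P\<in>\<P>. measure (M P n) (A P n)) \<longlonglongrightarrow> 0"
    and prob: "\<And>P n. P \<in> \<P> \<Longrightarrow> n \<ge> 1 \<Longrightarrow> prob_space (M P n)"
    and mem: "\<And>n. n \<ge> 1 \<Longrightarrow> Q n \<in> \<P>"
  shows "(\<lambda>n. measure (M (Q n) n) (A (Q n) n)) \<longlonglongrightarrow> 0"
proof (rule tendsto_sandwich[OF _ _ tendsto_const lim])
  show "\<forall>\<^sub>F n in sequentially.
      measure (M (Q n) n) (A (Q n) n) \<le> (SUP P\<in>\<P>. measure (M P n) (A P n))"
    using eventually_ge_at_top[of 1]
  proof eventually_elim
    case (elim n)
    then show ?case
      using prob_le_SUP[where M = "\<lambda>P. M P n" and A = "\<lambda>P. A P n"] prob mem by blast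
  qed
qed simp

theorem theorem2p1:
  fixes \<X> :: "(real ^ 'p::finite) set"
    and \<G> :: "'p policy set"
    and k :: real
    and \<P> :: "'p attributes measure set"
    and Z :: "'z measure"
    and D :: "'p attributes measure \<Rightarrow> nat \<Rightarrow> (nat \<Rightarrow> 'z) measure"
    and gs :: "'p attributes measure \<Rightarrow> 'p policy"
    and P0 :: "'p attributes measure"
    and Ph :: "nat \<Rightarrow> 'p attributes measure"
  assumes policies: "\<G> \<subseteq> policies \<X>"
    and distributions: "\<P> \<subseteq> space (prob_algebra (attribute_space \<X>))"
    and finite_expectations: "\<And>P g. P \<in> \<P> \<Longrightarrow> g \<in> \<G> \<Longrightarrow> finite_welfare_cost g P"
    and sampling: "\<And>P n. P \<in> \<P> \<Longrightarrow> n \<ge> 1 \<Longrightarrow> D P n \<in> space (prob_algebra (sample_space Z n))"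
    and optimum: "\<And>P. P \<in> \<P> \<Longrightarrow> constrained_optimum \<G> k P (gs P)"
    and P0: "P0 \<in> \<P>"
    and G0_nonempty: "{g \<in> \<G>. cost g P0 = k} \<noteq> {}"
    and Ph: "\<And>n. n \<ge> 1 \<Longrightarrow> Ph n \<in> \<P>"
    and contiguity: "contiguous (\<lambda>n. D (Ph n) n) (\<lambda>n. D P0 n)"
    and violation: "\<And>g. g \<in> {g \<in> \<G>. cost g P0 = k} \<Longrightarrow>
                      \<exists>c>0. \<forall>n\<ge>1. sqrt (real n) * (cost g (Ph n) - k) > c"
    and binding: "cost (gs P0) P0 = k"
    and separation: "\<exists>\<epsilon>>0. \<forall>g\<in>\<G>. cost g P0 \<le> k \<longrightarrow> \<bar>cost g P0 - cost (gs P0) P0\<bar> > 0 \<longrightarrow>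
                       welfare (gs P0) P0 - welfare g P0 > \<epsilon>"
  shows "\<not> (\<exists>r. statistical_rule \<G> \<P> Z r \<and> uniformly_efficient D gs \<P> r \<and> uniformly_feasible D k \<P> r)
       \<and> (\<forall>r. statistical_rule \<G> \<P> Z r \<and> pointwise_efficient D gs P0 r \<and> pointwise_feasible D k P0 r
              \<longrightarrow> \<not> uniformly_feasible D k \<P> r)"
proof -
  have prob: "prob_space (D P n)" and sets_D: "sets (D P n) = sets (sample_space Z n)"
    if "P \<in> \<P>" "n \<ge> 1" for P n
    using sampling[OF that] by (auto simp: space_prob_algebra)
  have not_feasible: "\<not> uniformly_feasible D k \<P> r"
    if rule: "statistical_rule \<G> \<P> Z r" and eff: "pointwise_efficient D gs P0 r"
      and feas: "pointwise_feasible D k P0 r" for r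
  proof
    assume "uniformly_feasible D k \<P> r"
    then have viol: "(\<lambda>n. \<P>(s in D (Ph n) n. cost (r n s) (Ph n) > k)) \<longlonglongrightarrow> 0"
      unfolding uniformly_feasible_def by (rule tendsto_zero_of_SUP) (use prob Ph in auto)
    from separation obtain \<epsilon> where "\<epsilon> > 0" and sep:
      "\<And>g. g \<in> \<G> \<Longrightarrow> cost g P0 \<le> k \<Longrightarrow> cost g P0 \<noteq> k \<Longrightarrow> welfare (gs P0) P0 - welfare g P0 > \<epsilon>"
      unfolding binding by auto
    have rG: "r n s \<in> \<G>" if "n \<ge> 1" "s \<in> space (sample_space Z n)" for n s
      using rule that unfolding statistical_rule_def by blast
    have [measurable]: "(\<lambda>s. welfare (r n s) P) \<in> borel_measurable (sample_space Z n)"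
        "(\<lambda>s. cost (r n s) P) \<in> borel_measurable (sample_space Z n)"
      if "n \<ge> 1" "P \<in> \<P>" for n P
      using rule that unfolding statistical_rule_def by blast+
    \<comment> \<open>The probabilities range over \<open>space (D Q n)\<close>, while measurability
      of the rule refers to \<open>sample_space Z n\<close>; the two agree for
      \<open>n \<ge> 1\<close>.\<close>
    have event: "{s \<in> space (D Q n). \<phi> s} \<in> sets (D Q n)"
      if "Q \<in> \<P>" "n \<ge> 1" "Measurable.pred (sample_space Z n) \<phi>" for Q n \<phi>
      using that(3) sets_D[OF that(1,2)] sets_eq_imp_space_eq[OF sets_D[OF that(1,2)]]
      by (simp add: pred_def)
    \<comment> \<open>The samples on which the rule misses the boundary under \<open>P0\<close>.
      Taken in the common sample space, the same set can be measured under \<open>P0\<close> and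
      under \<open>Ph n\<close>, as contiguity requires.\<close>
    define U where "U n = {s \<in> space (sample_space Z n). cost (r n s) P0 \<noteq> k}" for n
    have U_sets: "U n \<in> sets (D Q n)" if "Q \<in> \<P>" "n \<ge> 1" for Q n
      using P0 that unfolding U_def sets_D[OF that] by measurable
    \<comment> \<open>The welfare gap from separation serves as the tolerance in efficiency.\<close>
    have lim0: "(\<lambda>n. \<P>(s in D P0 n. cost (r n s) P0 > k)
        + \<P>(s in D P0 n. welfare (r n s) P0 - welfare (gs P0) P0 < - \<epsilon>)) \<longlonglongrightarrow> 0"
      using tendsto_add[of _ 0 sequentially _ 0] feas eff \<open>\<epsilon> > 0\<close>
      unfolding pointwise_feasible_def pointwise_efficient_def by auto
    have "(\<lambda>n. measure (D P0 n) (U n)) \<longlonglongrightarrow> 0"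
    proof (rule tendsto_sandwich[OF _ _ tendsto_const lim0])
      show "\<forall>\<^sub>F n in sequentially. measure (D P0 n) (U n) \<le> \<P>(s in D P0 n. cost (r n s) P0 > k)
          + \<P>(s in D P0 n. welfare (r n s) P0 - welfare (gs P0) P0 < - \<epsilon>)"
        using eventually_ge_at_top[of 1]
      proof eventually_elim
        case (elim n)
        interpret prob_space "D P0 n" using prob P0 elim by blast
        let ?H = "{s \<in> space (D P0 n). cost (r n s) P0 > k}"
        let ?L = "{s \<in> space (D P0 n). welfare (r n s) P0 - welfare (gs P0) P0 < - \<epsilon>}"
        have HL: "?H \<in> events" "?L \<in> events"
          using P0 elim by (auto intro!: event)
        \<comment> \<open>A cost above \<open>k\<close> lands in \<open>?H\<close>. A cost below
          \<open>k\<close> is feasible but off the boundary, so separation forces a loss exceeding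
          \<open>\<epsilon>\<close>, which is \<open>?L\<close>.\<close>
        have "U n \<subseteq> ?H \<union> ?L"
        proof
          fix s assume "s \<in> U n"
          then show "s \<in> ?H \<union> ?L"
            using sep[OF rG[OF elim, of s]] sets_eq_imp_space_eq[OF sets_D[OF P0 elim]]
            by (fastforce simp: U_def)
        qed
        then have "prob (U n) \<le> prob (?H \<union> ?L)"
          using HL by (intro finite_measure_mono) auto
        also have "\<dots> \<le> prob ?H + prob ?L"
          using HL by (rule measure_Un_le)
        finally show ?case .
      qed
    qed simp
    then have U_lim: "(\<lambda>n. measure (D (Ph n) n) (U n)) \<longlonglongrightarrow> 0"
    proof (rule contiguousD[OF contiguity, rotated])
      show "\<forall>\<^sub>F n in sequentially. U n \<in> sets (D P0 n)"
        using eventually_ge_at_top[of 1] by eventually_elim (rule U_sets[OF P0])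
    qed
    have "\<forall>\<^sub>F n in sequentially.
        1 \<le> measure (D (Ph n) n) (U n) + \<P>(s in D (Ph n) n. cost (r n s) (Ph n) > k)"
      using eventually_ge_at_top[of 1]
    proof eventually_elim
      case (elim n)
      interpret prob_space "D (Ph n) n" using prob Ph elim by blast
      let ?V = "{s \<in> space (D (Ph n) n). cost (r n s) (Ph n) > k}"
      have V: "?V \<in> events"
        using Ph[OF elim] elim by (auto intro!: event)
      \<comment> \<open>The constant \<open>c\<close> may depend on \<open>g\<close>, but at a fixed
        \<open>n\<close> it makes the product positive. As the root is nonnegative, the excess cost
        is positive too.\<close>
      have "cost g (Ph n) > k" if g: "g \<in> \<G>" "cost g P0 = k" for g
      proof -
        obtain c where "c > 0" "sqrt (real n) * (cost g (Ph n) - k) > c"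
          using violation[of g] g elim by auto
        then have "0 < sqrt (real n) * (cost g (Ph n) - k)" by linarith
        then show ?thesis by (simp add: zero_less_mult_iff)
      qed
      \<comment> \<open>Outside \<open>U n\<close> the rule picks a boundary policy, which
        overspends under \<open>Ph n\<close>; so \<open>U n\<close> and \<open>?V\<close> cover all
        samples.\<close>
      then have "space (D (Ph n) n) \<subseteq> U n \<union> ?V"
        using rG[OF elim] sets_eq_imp_space_eq[OF sets_D[OF Ph[OF elim] elim]]
        by (auto simp: U_def)
      then have "prob (space (D (Ph n) n)) \<le> prob (U n \<union> ?V)"
        using V U_sets[OF Ph[OF elim] elim] by (intro finite_measure_mono) auto
      also have "\<dots> \<le> prob (U n) + prob ?V"
        using V U_sets[OF Ph[OF elim] elim] by (intro measure_Un_le)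
      finally show ?case by (simp add: prob_space)
    qed
    moreover have "(\<lambda>n. measure (D (Ph n) n) (U n)
        + \<P>(s in D (Ph n) n. cost (r n s) (Ph n) > k)) \<longlonglongrightarrow> 0"
      using tendsto_add[OF U_lim viol] by simp
    \<comment> \<open>A sum that is eventually at least 1 would tend to 0.\<close>
    ultimately have "(1::real) \<le> 0"
      by (intro tendsto_lowerbound) auto
    then show False by simp
  qed
  \<comment> \<open>Uniform properties specialize to \<open>P0\<close>, which reduces the
    impossibility claim to \<open>not_feasible\<close>.\<close>
  have "pointwise_efficient D gs P0 r" if "uniformly_efficient D gs \<P> r" for r
    unfolding pointwise_efficient_def
  proof (intro allI impI)
    fix \<epsilon> :: real assume "\<epsilon> > 0"
    with that show "(\<lambda>n. \<P>(s in D P0 n. welfare (r n s) P0 - welfare (gs P0) P0 < - \<epsilon>)) \<longlonglongrightarrow> 0"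
      unfolding uniformly_efficient_def
      by (intro tendsto_zero_of_SUP[where Q = "\<lambda>_. P0"]) (use prob P0 in auto)
  qed
  moreover have "pointwise_feasible D k P0 r" if "uniformly_feasible D k \<P> r" for r
    using that unfolding uniformly_feasible_def pointwise_feasible_def
    by (rule tendsto_zero_of_SUP[where Q = "\<lambda>_. P0"]) (use prob P0 in auto)
  ultimately show ?thesis
    using not_feasible by blast
qed

end
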